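(* Let $a,b,c,d,e,f>0$ with $a+b=\min\{a+b,\,c+d,\,e+f\}$, and let $\mathcal{F}_1,\mathcal{F}_2,\mathcal{F}_3$ be the free linkages in the plane with length vectors $(a,b)$, $(c,d)$, $(e,f)$ respectively. Suppose that $(\mathcal{F}_1,\mathcal{F}_2,\mathcal{F}_3)$ is generic and that $0$ and $\pi$ are both possible angles for $\theta_1$ (i.e. both lie in the image of $p$). Let $\mathbf{v}=(v_1,v_2,v_3,v_4)\in\{0,1\}^4$ be defined by: $v_1=1$ iff $\mathcal{F}_2$ is collapsible, $v_2=1$ iff $\mathcal{F}_2$ is foldable, $v_3=1$ iff $\mathcal{F}_3$ is collapsible, $v_4=1$ iff $\mathcal{F}_3$ is foldable. The pairs of $\mathbf{v}$ are $(v_1,v_2)$ and $(v_3,v_4)$. Then the moduli space $M(\mathcal{F}_1,\mathcal{F}_2,\mathcal{F}_3)$ is obtained from four circles, with possible identifications of points, and: (1) the number of connected components of $M(\mathcal{F}_1,\mathcal{F}_2,\mathcal{F}_3)$ is $2^{k}$, where $k$ is the number of pairs of $\mathbf{v}$ equal to $(0,0)$; (2) the number of points in $p^{-1}(0)$ is $2^{\,2-(v_2+v_4)}$; (3) the number of points in $p^{-1}(\pi)$ is $2^{\,2-(v_1+v_3)}$.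
   Context: A free linkage in $\mathbb{R}^2$ with length vector $(d_1,d_2)$ has configurations $(x_1,x_2,x_3)\in(\mathbb{R}^2)^3$ with $|x_1-x_2|=d_1$, $|x_2-x_3|=d_2$; $x_1$ is its initial and $x_3$ its terminal vertex. $C(\mathcal{F}_1,\mathcal{F}_2,\mathcal{F}_3)$ is the space of triples of configurations of $\mathcal{F}_1,\mathcal{F}_2,\mathcal{F}_3$ with all initial vertices at the origin and all terminal vertices coinciding, and $M(\mathcal{F}_1,\mathcal{F}_2,\mathcal{F}_3)=C(\mathcal{F}_1,\mathcal{F}_2,\mathcal{F}_3)/SO(2)$. For each $i$, $\theta_i\in[0,2\pi)$ (taken mod $2\pi$) is the clockwise angle, at the middle vertex of $\mathcal{F}_i$, from the first edge to the second edge of $\mathcal{F}_i$; thus $\theta_i=\pi$ means that the two edges are stretched out in a straight line and $\theta_i=0$ means that they are folded onto one another. The map $p:M(\mathcal{F}_1,\mathcal{F}_2,\mathcal{F}_3)\to S^1$ sends a configuration to its angle $\theta_1$. The linkage is called generic if $a=b$, $c=d$ and $e=f$ are not simultaneously true. $\mathcal{F}_i$ is called collapsible if there is at least one configuration in $M(\mathcal{F}_1,\mathcal{F}_2,\mathcal{F}_3)$ in which $\mathcal{F}_i$ lies in a straight line with $\theta_i=\pi$, and foldable if there is at least one configuration in $M(\mathcal{F}_1,\mathcal{F}_2,\mathcal{F}_3)$ in which $\mathcal{F}_i$ lies in a straight line with $\theta_i=0$. *)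

theory Defs
  imports "HOL-Analysis.Analysis"
begin

text \<open>The Euclidean plane is identified with \<^typ>\<open>complex\<close>; SO(2) is the group of complex
  numbers of modulus 1, acting by multiplication.\<close>

type_synonym config = "complex \<times> complex \<times> complex"
type_synonym config_triple = "config \<times> config \<times> config"

definition free_linkage :: "real \<times> real \<Rightarrow> config set" where
  "free_linkage = (\<lambda>(d\<^sub>1, d\<^sub>2). {(x\<^sub>1, x\<^sub>2, x\<^sub>3). dist x\<^sub>1 x\<^sub>2 = d\<^sub>1 \<and> dist x\<^sub>2 x\<^sub>3 = d\<^sub>2})"

definition initial :: "config \<Rightarrow> complex" where
  "initial = (\<lambda>(x\<^sub>1, x\<^sub>2, x\<^sub>3). x\<^sub>1)"

definition terminal :: "config \<Rightarrow> complex" where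
  "terminal = (\<lambda>(x\<^sub>1, x\<^sub>2, x\<^sub>3). x\<^sub>3)"

text \<open>The clockwise angle in \<open>[0, 2\<pi>)\<close> at \<open>x\<^sub>2\<close> from the edge \<open>x\<^sub>2 x\<^sub>1\<close> to the edge \<open>x\<^sub>2 x\<^sub>3\<close>:
  it is the number \<open>\<theta>\<close> for which \<open>x\<^sub>3 - x\<^sub>2\<close> is a positive multiple of \<open>cis (- \<theta>) * (x\<^sub>1 - x\<^sub>2)\<close>.\<close>

definition middle_angle :: "config \<Rightarrow> real" where
  "middle_angle = (\<lambda>(x\<^sub>1, x\<^sub>2, x\<^sub>3). Arg2pi ((x\<^sub>1 - x\<^sub>2) / (x\<^sub>3 - x\<^sub>2)))"

definition config_space :: "real \<times> real \<Rightarrow> real \<times> real \<Rightarrow> real \<times> real \<Rightarrow> config_triple set" where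
  "config_space F\<^sub>1 F\<^sub>2 F\<^sub>3 = {(u\<^sub>1, u\<^sub>2, u\<^sub>3).
     u\<^sub>1 \<in> free_linkage F\<^sub>1 \<and> u\<^sub>2 \<in> free_linkage F\<^sub>2 \<and> u\<^sub>3 \<in> free_linkage F\<^sub>3 \<and>
     initial u\<^sub>1 = 0 \<and> initial u\<^sub>2 = 0 \<and> initial u\<^sub>3 = 0 \<and>
     terminal u\<^sub>1 = terminal u\<^sub>2 \<and> terminal u\<^sub>2 = terminal u\<^sub>3}"

definition SO2 :: "complex set" where
  "SO2 = {z. norm z = 1}"

definition rotate_config :: "complex \<Rightarrow> config \<Rightarrow> config" where
  "rotate_config z = (\<lambda>(x\<^sub>1, x\<^sub>2, x\<^sub>3). (z * x\<^sub>1, z * x\<^sub>2, z * x\<^sub>3))"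

definition rotate_triple :: "complex \<Rightarrow> config_triple \<Rightarrow> config_triple" where
  "rotate_triple z =
     (\<lambda>(u\<^sub>1, u\<^sub>2, u\<^sub>3). (rotate_config z u\<^sub>1, rotate_config z u\<^sub>2, rotate_config z u\<^sub>3))"

definition SO2_orbit :: "config_triple \<Rightarrow> config_triple set" where
  "SO2_orbit u = (\<lambda>z. rotate_triple z u) ` SO2"

definition moduli :: "real \<times> real \<Rightarrow> real \<times> real \<Rightarrow> real \<times> real \<Rightarrow> config_triple set set" where
  "moduli F\<^sub>1 F\<^sub>2 F\<^sub>3 = SO2_orbit ` config_space F\<^sub>1 F\<^sub>2 F\<^sub>3"

text \<open>The quotient topology; see \<open>quotient_map_SO2_orbit\<close> below.\<close>

definition moduli_topology ::
    "real \<times> real \<Rightarrow> real \<times> real \<Rightarrow> real \<times> real \<Rightarrow> config_triple set topology" where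
  "moduli_topology F\<^sub>1 F\<^sub>2 F\<^sub>3 = topology (\<lambda>U. U \<subseteq> moduli F\<^sub>1 F\<^sub>2 F\<^sub>3 \<and>
     openin (top_of_set (config_space F\<^sub>1 F\<^sub>2 F\<^sub>3)) {u \<in> config_space F\<^sub>1 F\<^sub>2 F\<^sub>3. SO2_orbit u \<in> U})"

lemma openin_moduli_topology:
  "openin (moduli_topology F\<^sub>1 F\<^sub>2 F\<^sub>3) U \<longleftrightarrow> U \<subseteq> moduli F\<^sub>1 F\<^sub>2 F\<^sub>3 \<and>
     openin (top_of_set (config_space F\<^sub>1 F\<^sub>2 F\<^sub>3)) {u \<in> config_space F\<^sub>1 F\<^sub>2 F\<^sub>3. SO2_orbit u \<in> U}"
proof -
  let ?C = "config_space F\<^sub>1 F\<^sub>2 F\<^sub>3"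
  let ?P = "\<lambda>U. {u \<in> ?C. SO2_orbit u \<in> U}"
  have "istopology (\<lambda>U. U \<subseteq> moduli F\<^sub>1 F\<^sub>2 F\<^sub>3 \<and> openin (top_of_set ?C) (?P U))"
    unfolding istopology_def
  proof (intro conjI allI impI)
    fix S T
    assume "S \<subseteq> moduli F\<^sub>1 F\<^sub>2 F\<^sub>3 \<and> openin (top_of_set ?C) (?P S)"
      and "T \<subseteq> moduli F\<^sub>1 F\<^sub>2 F\<^sub>3 \<and> openin (top_of_set ?C) (?P T)"
    moreover have "?P (S \<inter> T) = ?P S \<inter> ?P T" by auto
    ultimately show "S \<inter> T \<subseteq> moduli F\<^sub>1 F\<^sub>2 F\<^sub>3" "openin (top_of_set ?C) (?P (S \<inter> T))"
      by (auto simp: openin_Int)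
  next
    fix \<K>
    assume K: "\<forall>K\<in>\<K>. K \<subseteq> moduli F\<^sub>1 F\<^sub>2 F\<^sub>3 \<and> openin (top_of_set ?C) (?P K)"
    then show "\<Union>\<K> \<subseteq> moduli F\<^sub>1 F\<^sub>2 F\<^sub>3" by blast
    have "?P (\<Union>\<K>) = (\<Union>K\<in>\<K>. ?P K)" by auto
    with K show "openin (top_of_set ?C) (?P (\<Union>\<K>))" by (simp add: openin_clauses(3))
  qed
  then show ?thesis by (simp add: moduli_topology_def)
qed

lemma topspace_moduli_topology [simp]:
  "topspace (moduli_topology F\<^sub>1 F\<^sub>2 F\<^sub>3) = moduli F\<^sub>1 F\<^sub>2 F\<^sub>3"
proof -
  have "{u \<in> config_space F\<^sub>1 F\<^sub>2 F\<^sub>3. SO2_orbit u \<in> moduli F\<^sub>1 F\<^sub>2 F\<^sub>3} = config_space F\<^sub>1 F\<^sub>2 F\<^sub>3"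
    by (auto simp: moduli_def)
  then have "openin (moduli_topology F\<^sub>1 F\<^sub>2 F\<^sub>3) (moduli F\<^sub>1 F\<^sub>2 F\<^sub>3)"
    by (simp add: openin_moduli_topology)
  then show ?thesis
    by (meson openin_moduli_topology openin_subset openin_topspace subset_antisym)
qed

lemma quotient_map_SO2_orbit:
  "quotient_map (top_of_set (config_space F\<^sub>1 F\<^sub>2 F\<^sub>3)) (moduli_topology F\<^sub>1 F\<^sub>2 F\<^sub>3) SO2_orbit"
  by (auto simp: quotient_map_def openin_moduli_topology moduli_def)

text \<open>The \<open>i\<close>-th linkage of a triple, for \<open>i \<in> {1, 2, 3}\<close>.\<close>

definition linkage :: "nat \<Rightarrow> config_triple \<Rightarrow> config" where
  "linkage i = (\<lambda>(u\<^sub>1, u\<^sub>2, u\<^sub>3). if i = 1 then u\<^sub>1 else if i = 2 then u\<^sub>2 else u\<^sub>3)"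

text \<open>The angle \<open>\<theta>\<^sub>i\<close> is rotation-invariant, hence a function of the orbit.\<close>

lemma middle_angle_rotate:
  assumes "z \<in> SO2"
  shows "middle_angle (linkage i (rotate_triple z u)) = middle_angle (linkage i u)"
proof -
  have "z \<noteq> 0" using assms by (auto simp: SO2_def)
  then show ?thesis
    by (auto simp: middle_angle_def linkage_def rotate_triple_def rotate_config_def
        split: prod.splits simp flip: right_diff_distrib)
qed

definition theta :: "nat \<Rightarrow> config_triple set \<Rightarrow> real" where
  "theta i K = the_elem ((\<lambda>u. middle_angle (linkage i u)) ` K)"

lemma theta_SO2_orbit: "theta i (SO2_orbit u) = middle_angle (linkage i u)"
proof -
  have "1 \<in> SO2" by (simp add: SO2_def)
  then have "(\<lambda>v. middle_angle (linkage i v)) ` SO2_orbit u = {middle_angle (linkage i u)}"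
    unfolding SO2_orbit_def image_image by (auto simp: middle_angle_rotate cong: image_cong)
  then show ?thesis by (simp add: theta_def)
qed

text \<open>The map to the circle given by \<open>\<theta>\<^sub>1\<close>; the angle \<open>\<phi>\<close> corresponds to the point \<open>cis \<phi>\<close>.\<close>

definition angle_map :: "config_triple set \<Rightarrow> complex" where
  "angle_map K = cis (theta 1 K)"

definition straight :: "config \<Rightarrow> bool" where
  "straight = (\<lambda>(x\<^sub>1, x\<^sub>2, x\<^sub>3). collinear {x\<^sub>1, x\<^sub>2, x\<^sub>3})"

definition collapsible :: "nat \<Rightarrow> real \<times> real \<Rightarrow> real \<times> real \<Rightarrow> real \<times> real \<Rightarrow> bool" where
  "collapsible i F\<^sub>1 F\<^sub>2 F\<^sub>3 \<longleftrightarrow>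
     (\<exists>K \<in> moduli F\<^sub>1 F\<^sub>2 F\<^sub>3. (\<forall>u \<in> K. straight (linkage i u)) \<and> theta i K = pi)"

definition foldable :: "nat \<Rightarrow> real \<times> real \<Rightarrow> real \<times> real \<Rightarrow> real \<times> real \<Rightarrow> bool" where
  "foldable i F\<^sub>1 F\<^sub>2 F\<^sub>3 \<longleftrightarrow>
     (\<exists>K \<in> moduli F\<^sub>1 F\<^sub>2 F\<^sub>3. (\<forall>u \<in> K. straight (linkage i u)) \<and> theta i K = 0)"

definition generic :: "real \<times> real \<Rightarrow> real \<times> real \<Rightarrow> real \<times> real \<Rightarrow> bool" where
  "generic = (\<lambda>(a, b) (c, d) (e, f). \<not> (a = b \<and> c = d \<and> e = f))"

text \<open>A space is obtained from \<open>n\<close> circles by identifying points if it is a quotient of the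
  disjoint union of \<open>n\<close> circles in which only finitely many points are identified with another
  point.\<close>

definition obtained_from_circles :: "nat \<Rightarrow> 'a topology \<Rightarrow> bool" where
  "obtained_from_circles n X \<longleftrightarrow>
     (let D = sum_topology (\<lambda>_. top_of_set (sphere (0::complex) 1)) {..<n} in
        \<exists>q. quotient_map D X q \<and>
            finite {w \<in> topspace D. \<exists>w' \<in> topspace D. w' \<noteq> w \<and> q w' = q w})"

end

theory Submission
  imports Defs
begin

text \<open>
  Every rotation orbit contains exactly one configuration in which the elbow of \<open>\<F>\<^sub>1\<close> is the
  positive real number \<open>a\<close>, so the moduli space is homeomorphic to the slice of these
  configurations (\<open>homeomorphic_map_slice\<close>). In the slice the common endpoint is
  \<open>tip z = a - b * cnj z\<close>, where \<open>z = cis \<theta>\<^sub>1\<close> runs through the unit circle. If \<open>a = b\<close>, the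
  assumption that \<open>\<theta>\<^sub>1 = 0\<close> occurs would force \<open>c = d\<close> and \<open>e = f\<close>, which genericity
  excludes; hence the endpoint never meets the origin.

  By the law of cosines the distance of \<open>tip z\<close> from the origin lies between \<open>\<bar>a - b\<bar>\<close>, attained
  only at \<open>z = 1\<close>, and \<open>a + b\<close>, attained only at \<open>z = -1\<close>. The hypotheses say that \<open>\<F>\<^sub>2\<close> and
  \<open>\<F>\<^sub>3\<close> can span all these distances. Over a given endpoint the elbow of \<open>\<F>\<^sub>2\<close> therefore has two
  positions, mirror images in the line through the origin and the endpoint; they coincide
  exactly when the triangle with sides \<open>c\<close>, \<open>d\<close> and \<open>cmod (tip z)\<close> is degenerate. That happens at
  \<open>z = -1\<close> if \<open>c + d = a + b\<close>, which is collapsibility, at \<open>z = 1\<close> if \<open>\<bar>c - d\<bar> = \<bar>a - b\<bar>\<close>, which is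
  foldability, and nowhere else (\<open>altitude_over_circle\<close>, \<open>collapsible_iff\<close>, \<open>foldable_iff\<close>).
  The same holds for \<open>\<F>\<^sub>3\<close>.

  Choosing one of the two sides for each of \<open>\<F>\<^sub>2\<close> and \<open>\<F>\<^sub>3\<close> gives four circles, parametrized by
  \<open>z\<close>, that cover the slice and meet only over \<open>z = 1\<close> and \<open>z = -1\<close>. Counting the distinct elbow
  positions there gives the two fibres. For the components, the side of an elbow is locally
  constant if its triangle never degenerates, whereas at a degenerate triangle one can pass to
  the other side; so each of \<open>\<F>\<^sub>2\<close> and \<open>\<F>\<^sub>3\<close> contributes a factor 2 if it is neither collapsible
  nor foldable, and a factor 1 otherwise (\<open>connected_component_iff_label\<close>).
\<close>

section \<open>The angle of a free linkage and the distance that it spans\<close>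

lemma law_of_cosines:
  assumes "u \<in> free_linkage (p, q)" "p > 0" "q > 0"
  shows "(dist (initial u) (terminal u))\<^sup>2 = p\<^sup>2 + q\<^sup>2 - 2 * p * q * cos (middle_angle u)"
proof -
  obtain x y z where u: "u = (x, y, z)" by (cases u)
  define v w where "v = x - y" and "w = z - y"
  have v: "cmod v = p" and w: "cmod w = q"
    using assms(1) by (auto simp: u free_linkage_def v_def w_def dist_norm norm_minus_commute)
  have "w \<noteq> 0" using w assms by auto
  have "cmod (v / w) * cos (Arg2pi (v / w)) = Re (v / w)" by (rule cos_Arg2pi)
  also have "\<dots> = (v \<bullet> w) / q\<^sup>2"
    by (simp add: Re_divide inner_complex_def cmod_power2 flip: w)
  finally have "p / q * cos (middle_angle u) = (v \<bullet> w) / q\<^sup>2"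
    by (simp add: u middle_angle_def v_def[symmetric] w_def[symmetric] norm_divide v w)
  then have vw: "v \<bullet> w = p * q * cos (middle_angle u)"
    using assms by (simp add: field_simps power2_eq_square)
  have "dist (initial u) (terminal u) = norm (v - w)"
    by (simp add: u initial_def terminal_def v_def w_def dist_norm)
  then have "(dist (initial u) (terminal u))\<^sup>2 = (v - w) \<bullet> (v - w)"
    by (simp add: power2_norm_eq_inner)
  also have "\<dots> = v \<bullet> v + w \<bullet> w - 2 * (v \<bullet> w)"
    by (simp add: inner_diff inner_commute)
  finally show ?thesis
    using v w by (simp add: vw flip: power2_norm_eq_inner)
qed

lemma middle_angle_bounds: "0 \<le> middle_angle u" "middle_angle u < 2 * pi"
  using Arg2pi by (auto simp: middle_angle_def split: prod.splits)

lemma span_bounds: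
  assumes "u \<in> free_linkage (p, q)"
  shows "\<bar>p - q\<bar> \<le> dist (initial u) (terminal u)" "dist (initial u) (terminal u) \<le> p + q"
proof -
  obtain x y z where u: "u = (x, y, z)" by (cases u)
  show "\<bar>p - q\<bar> \<le> dist (initial u) (terminal u)" "dist (initial u) (terminal u) \<le> p + q"
    using assms dist_triangle[of x z y] dist_triangle[of x y z] dist_triangle[of y z x]
    by (auto simp: u free_linkage_def initial_def terminal_def dist_commute)
qed

lemma cis_eq_1_iff: "0 \<le> \<phi> \<Longrightarrow> \<phi> < 2 * pi \<Longrightarrow> cis \<phi> = 1 \<longleftrightarrow> \<phi> = 0"
  by (auto simp: complex_eq_iff cos_one_2pi_int zero_le_mult_iff pi_gt_zero[folded not_le])

lemma cis_eq_minus_1_iff: "0 \<le> \<phi> \<Longrightarrow> \<phi> < 2 * pi \<Longrightarrow> cis \<phi> = -1 \<longleftrightarrow> \<phi> = pi"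
  by (auto simp: complex_eq_iff cos_eq_minus1 zero_le_mult_iff pi_gt_zero[folded not_le])

lemma middle_angle_eq_pi_iff:
  assumes "u \<in> free_linkage (p, q)" "p > 0" "q > 0"
  shows "middle_angle u = pi \<longleftrightarrow> dist (initial u) (terminal u) = p + q"
proof -
  have "dist (initial u) (terminal u) = p + q \<longleftrightarrow> (dist (initial u) (terminal u))\<^sup>2 = (p + q)\<^sup>2"
    using assms by (smt (verit) power2_eq_iff zero_le_dist)
  also have "\<dots> \<longleftrightarrow> p * q * (cos (middle_angle u) + 1) = 0"
    unfolding law_of_cosines[OF assms] by (auto simp: power2_eq_square algebra_simps)
  also have "\<dots> \<longleftrightarrow> cos (middle_angle u) = -1"
    using assms by auto
  also have "\<dots> \<longleftrightarrow> middle_angle u = pi"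
    using middle_angle_bounds[of u] by (auto simp: cos_eq_minus1 zero_le_mult_iff pi_gt_zero[folded not_le])
  finally show ?thesis by simp
qed

lemma middle_angle_eq_0_iff:
  assumes "u \<in> free_linkage (p, q)" "p > 0" "q > 0"
  shows "middle_angle u = 0 \<longleftrightarrow> dist (initial u) (terminal u) = \<bar>p - q\<bar>"
proof -
  have "dist (initial u) (terminal u) = \<bar>p - q\<bar> \<longleftrightarrow> (dist (initial u) (terminal u))\<^sup>2 = (p - q)\<^sup>2"
    by (metis abs_of_nonneg power2_abs power2_eq_iff_nonneg abs_ge_zero zero_le_dist)
  also have "\<dots> \<longleftrightarrow> p * q * (cos (middle_angle u) - 1) = 0"
    unfolding law_of_cosines[OF assms] by (auto simp: power2_eq_square algebra_simps)
  also have "\<dots> \<longleftrightarrow> cos (middle_angle u) = 1"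
    using assms by auto
  also have "\<dots> \<longleftrightarrow> middle_angle u = 0"
    using middle_angle_bounds[of u] by (auto simp: cos_one_2pi_int zero_le_mult_iff pi_gt_zero[folded not_le])
  finally show ?thesis by simp
qed

text \<open>The angle is \<open>0\<close> or \<open>\<pi>\<close> exactly when the quotient of the two edges is real, so the straightness
  demanded of collapsible and foldable linkages is implied by the value of the angle.\<close>

lemma straight_if_middle_angle:
  assumes "u \<in> free_linkage (p, q)" "q > 0" "middle_angle u \<in> {0, pi}"
  shows "straight u"
proof -
  obtain x y z where u: "u = (x, y, z)" by (cases u)
  have "z \<noteq> y" using assms by (auto simp: u free_linkage_def)
  have "(x - y) / (z - y) \<in> \<real>"
    using assms(3) Arg2pi_eq_0_pi by (auto simp: u middle_angle_def)
  then obtain r where "(x - y) / (z - y) = of_real r" by (auto elim: Reals_cases)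
  then have "x - y = r *\<^sub>R (z - y)"
    using \<open>z \<noteq> y\<close> by (simp add: field_simps scaleR_conv_of_real)
  then have "collinear {0, z - y, x - y}" by (auto simp: collinear_lemma)
  then have "collinear {z, y, x}" by (subst collinear_3) auto
  then show ?thesis by (simp add: u straight_def insert_commute)
qed

section \<open>The two positions of an elbow over a given endpoint\<close>

text \<open>Consider a triangle with a base of length \<open>r\<close> and legs of lengths \<open>p\<close> and \<open>q\<close> at the start and the
  end of the base. The foot of the altitude and the altitude itself are measured in units of
  the base \<open>r\<close>, so that the apex is obtained by complex multiplication with the base vector. The
  altitude is Heron's formula, in the factored form that shows where it vanishes.\<close>

definition foot :: "real \<Rightarrow> real \<Rightarrow> real \<Rightarrow> real" where
  "foot p q r = (r\<^sup>2 + p\<^sup>2 - q\<^sup>2) / (2 * r\<^sup>2)"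

definition altitude :: "real \<Rightarrow> real \<Rightarrow> real \<Rightarrow> real" where
  "altitude p q r = sqrt (((p + q)\<^sup>2 - r\<^sup>2) * (r\<^sup>2 - (p - q)\<^sup>2)) / (2 * r\<^sup>2)"

text \<open>The sign \<open>s\<close> is \<open>1\<close> for the apex to the left of the base \<open>t\<close>, and \<open>-1\<close> for the apex to its right.\<close>

definition elbow :: "real \<Rightarrow> real \<Rightarrow> real \<Rightarrow> complex \<Rightarrow> complex" where
  "elbow p q s t = t * Complex (foot p q (cmod t)) (s * altitude p q (cmod t))"

lemma altitude_squared:
  assumes "r > 0" "\<bar>p - q\<bar> \<le> r" "r \<le> p + q"
  shows "(altitude p q r)\<^sup>2 = (p / r)\<^sup>2 - (foot p q r)\<^sup>2"
proof -
  have "(p - q)\<^sup>2 \<le> r\<^sup>2" using assms by (metis abs_le_square_iff abs_of_pos)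
  moreover have "r\<^sup>2 \<le> (p + q)\<^sup>2" using assms by (intro power_mono) auto
  ultimately have "(altitude p q r)\<^sup>2 = ((p + q)\<^sup>2 - r\<^sup>2) * (r\<^sup>2 - (p - q)\<^sup>2) / (2 * r\<^sup>2)\<^sup>2"
    by (simp add: altitude_def power_divide)
  also have "\<dots> = (p / r)\<^sup>2 - (foot p q r)\<^sup>2"
    using assms(1) by (simp add: foot_def field_simps power2_eq_square)
  finally show ?thesis .
qed

lemma altitude_eq_0_iff:
  assumes "r > 0" "\<bar>p - q\<bar> \<le> r" "r \<le> p + q"
  shows "altitude p q r = 0 \<longleftrightarrow> r = p + q \<or> r = \<bar>p - q\<bar>"
proof -
  have "altitude p q r = 0 \<longleftrightarrow> (p + q)\<^sup>2 = r\<^sup>2 \<or> r\<^sup>2 = (p - q)\<^sup>2"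
    using assms(1) by (simp add: altitude_def)
  also have "(p + q)\<^sup>2 = r\<^sup>2 \<longleftrightarrow> r = p + q"
    using assms by (auto simp: power2_eq_iff)
  also have "r\<^sup>2 = (p - q)\<^sup>2 \<longleftrightarrow> r = \<bar>p - q\<bar>"
    using assms by (auto simp: power2_eq_iff)
  finally show ?thesis .
qed

lemma altitude_nonneg:
  assumes "r > 0" "\<bar>p - q\<bar> \<le> r" "r \<le> p + q"
  shows "altitude p q r \<ge> 0"
proof -
  have "(p - q)\<^sup>2 \<le> r\<^sup>2" using assms by (metis abs_le_square_iff abs_of_pos)
  moreover have "r\<^sup>2 \<le> (p + q)\<^sup>2" using assms by (intro power_mono) auto
  ultimately show ?thesis by (simp add: altitude_def)
qed

text \<open>In the coordinate \<open>w = y / t\<close> the two circles about \<open>0\<close> and \<open>t\<close> become circles about \<open>0\<close> and \<open>1\<close>.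
  Subtracting their equations determines the real part of \<open>w\<close>, and the equation of one circle
  then determines its imaginary part up to sign.\<close>

lemma elbow_iff:
  assumes "t \<noteq> 0" "p > 0" "q > 0" "\<bar>p - q\<bar> \<le> cmod t" "cmod t \<le> p + q"
  shows "cmod y = p \<and> dist y t = q \<longleftrightarrow> (\<exists>s\<in>{1, -1}. y = elbow p q s t)"
proof -
  define r where "r = cmod t"
  have r: "r > 0" using assms(1) by (simp add: r_def)
  define w where "w = y / t"
  have y: "y = t * w" using assms(1) by (simp add: w_def)
  have "cmod y = p \<longleftrightarrow> (cmod y)\<^sup>2 = p\<^sup>2"
    using assms(2) by (smt (verit) norm_ge_zero power2_eq_iff)
  then have *: "cmod y = p \<longleftrightarrow> r\<^sup>2 * ((Re w)\<^sup>2 + (Im w)\<^sup>2) = p\<^sup>2"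
    by (simp add: y norm_mult power_mult_distrib r_def cmod_power2)
  have "y - t = t * (w - 1)" by (simp add: y algebra_simps)
  then have "(dist y t)\<^sup>2 = r\<^sup>2 * ((Re w - 1)\<^sup>2 + (Im w)\<^sup>2)"
    by (simp add: dist_norm norm_mult power_mult_distrib r_def cmod_power2)
  moreover have "dist y t = q \<longleftrightarrow> (dist y t)\<^sup>2 = q\<^sup>2"
    using assms(3) by (smt (verit) power2_eq_iff zero_le_dist)
  ultimately have **: "dist y t = q \<longleftrightarrow> r\<^sup>2 * ((Re w - 1)\<^sup>2 + (Im w)\<^sup>2) = q\<^sup>2" by simp
  have "cmod y = p \<and> dist y t = q \<longleftrightarrow>
      r\<^sup>2 * ((Re w)\<^sup>2 + (Im w)\<^sup>2) = p\<^sup>2 \<and> r\<^sup>2 * (2 * Re w) = r\<^sup>2 + p\<^sup>2 - q\<^sup>2"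
    unfolding * ** by (auto simp: power2_eq_square algebra_simps)
  also have "\<dots> \<longleftrightarrow> (Re w)\<^sup>2 + (Im w)\<^sup>2 = (p / r)\<^sup>2 \<and> Re w = foot p q r"
    using r by (simp add: foot_def field_simps)
  also have "\<dots> \<longleftrightarrow> (Im w)\<^sup>2 = (altitude p q r)\<^sup>2 \<and> Re w = foot p q r"
    using altitude_squared[of r p q] r assms by (auto simp: r_def)
  also have "\<dots> \<longleftrightarrow> (\<exists>s\<in>{1, -1}. w = Complex (foot p q r) (s * altitude p q r))"
    by (auto simp: power2_eq_iff complex_eq_iff)
  also have "\<dots> \<longleftrightarrow> (\<exists>s\<in>{1, -1}. y = elbow p q s t)"
    using assms(1) by (simp add: y elbow_def r_def)
  finally show ?thesis .
qed

lemma elbow_eq_iff: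
  assumes "t \<noteq> 0"
  shows "elbow p q s t = elbow p q s' t \<longleftrightarrow> s = s' \<or> altitude p q (cmod t) = 0"
  using assms by (auto simp: elbow_def complex_eq_iff)

lemma continuous_on_elbow:
  assumes "0 \<notin> S"
  shows "continuous_on S (elbow p q s)"
  unfolding elbow_def foot_def altitude_def Complex_eq
  using assms by (intro continuous_intros) auto

section \<open>The moduli space as a slice of the configuration space\<close>

text \<open>A cross-section of the rotation action: rotations move the elbow of the first linkage freely along
  the circle of radius \<open>fst F\<^sub>1\<close>, and here it is fixed at the positive real point of that circle.\<close>

definition slice :: "real \<times> real \<Rightarrow> real \<times> real \<Rightarrow> real \<times> real \<Rightarrow> config_triple set" where
  "slice F\<^sub>1 F\<^sub>2 F\<^sub>3 = {u \<in> config_space F\<^sub>1 F\<^sub>2 F\<^sub>3. fst (snd (fst u)) = of_real (fst F\<^sub>1)}"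

lemma rotate_triple_mult: "rotate_triple z (rotate_triple w u) = rotate_triple (z * w) u"
  by (auto simp: rotate_triple_def rotate_config_def mult_ac split: prod.splits)

lemma rotate_triple_1 [simp]: "rotate_triple 1 u = u"
  by (auto simp: rotate_triple_def rotate_config_def split: prod.splits)

lemma first_elbow_rotate: "fst (snd (fst (rotate_triple z u))) = z * fst (snd (fst u))"
  by (auto simp: rotate_triple_def rotate_config_def split: prod.splits)

lemma rotate_triple_in_config_space:
  assumes "z \<in> SO2" "u \<in> config_space F\<^sub>1 F\<^sub>2 F\<^sub>3"
  shows "rotate_triple z u \<in> config_space F\<^sub>1 F\<^sub>2 F\<^sub>3"
proof -
  have [simp]: "dist (z * x) (z * y) = dist x y" for x y
    using assms(1) by (simp add: SO2_def dist_norm norm_mult flip: right_diff_distrib)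
  have [simp]: "cmod (z * x) = cmod x" for x
    using assms(1) by (simp add: SO2_def norm_mult)
  show ?thesis
    using assms(2)
    by (auto simp: config_space_def free_linkage_def initial_def terminal_def
        rotate_triple_def rotate_config_def)
qed

lemma SO2_orbit_rotate:
  assumes "z \<in> SO2"
  shows "SO2_orbit (rotate_triple z u) = SO2_orbit u"
proof -
  have "(\<lambda>w. w * z) ` SO2 = SO2"
  proof (intro equalityI subsetI)
    fix w assume w: "w \<in> SO2"
    have "w = (w / z) * z" "w / z \<in> SO2"
      using assms w by (auto simp: SO2_def norm_divide)
    then show "w \<in> (\<lambda>w. w * z) ` SO2" by blast
  qed (use assms in \<open>auto simp: SO2_def norm_mult\<close>)
  then have "(\<lambda>w. rotate_triple w u) ` (\<lambda>w. w * z) ` SO2 = SO2_orbit u"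
    by (simp add: SO2_orbit_def)
  then show ?thesis by (simp add: SO2_orbit_def rotate_triple_mult image_image)
qed

lemma self_in_SO2_orbit: "u \<in> SO2_orbit u"
  unfolding SO2_orbit_def by (rule image_eqI[of _ _ 1]) (auto simp: SO2_def)

text \<open>Dividing a configuration by the phase of its first elbow is a continuous retraction of the
  configuration space onto the slice that is constant on orbits. It descends to the quotient and
  inverts there the restriction of the orbit map to the slice.\<close>

lemma homeomorphic_map_slice:
  assumes "a > 0"
  shows "homeomorphic_map (top_of_set (slice (a, b) F\<^sub>2 F\<^sub>3)) (moduli_topology (a, b) F\<^sub>2 F\<^sub>3) SO2_orbit"
proof -
  let ?C = "config_space (a, b) F\<^sub>2 F\<^sub>3" and ?S = "slice (a, b) F\<^sub>2 F\<^sub>3"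
  define e where "e u = fst (snd (fst u))" for u :: config_triple
  define \<nu> where "\<nu> u = rotate_triple (of_real a / e u) u" for u
  have e_norm: "cmod (e u) = a" if "u \<in> ?C" for u
    using that by (auto simp: e_def config_space_def free_linkage_def initial_def dist_norm)
  have e_nz: "e u \<noteq> 0" if "u \<in> ?C" for u
    using e_norm[OF that] assms by auto
  have phase: "of_real a / e u \<in> SO2" if "u \<in> ?C" for u
    using e_norm[OF that] assms by (simp add: SO2_def norm_divide)
  have \<nu>_slice: "\<nu> u \<in> ?S" if "u \<in> ?C" for u
    using rotate_triple_in_config_space[OF phase[OF that] that] e_nz[OF that]
    by (simp add: slice_def \<nu>_def first_elbow_rotate e_def)
  have \<nu>_rotate: "\<nu> (rotate_triple z u) = \<nu> u" if "z \<in> SO2" for z u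
  proof -
    have "z \<noteq> 0" using that by (auto simp: SO2_def)
    then show ?thesis by (simp add: \<nu>_def e_def first_elbow_rotate rotate_triple_mult)
  qed
  have \<nu>_fix: "\<nu> u = u" if "u \<in> ?S" for u
    using that assms by (simp add: \<nu>_def slice_def e_def)
  define g where "g K = \<nu> (SOME u. u \<in> K)" for K
  have g_orbit: "g (SO2_orbit u) = \<nu> u" for u
  proof -
    have "(SOME v. v \<in> SO2_orbit u) \<in> SO2_orbit u"
      using self_in_SO2_orbit by (rule someI)
    then show ?thesis
      unfolding g_def by (auto simp: SO2_orbit_def \<nu>_rotate)
  qed
  have "continuous_on ?C \<nu>"
    unfolding \<nu>_def rotate_triple_def rotate_config_def e_def case_prod_unfold
    using e_nz by (intro continuous_intros) (auto simp: e_def)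
  then have "continuous_map (top_of_set ?C) (top_of_set ?S) (g \<circ> SO2_orbit)"
    using \<nu>_slice by (auto simp: o_def g_orbit)
  then have g: "continuous_map (moduli_topology (a, b) F\<^sub>2 F\<^sub>3) (top_of_set ?S) g"
    using continuous_compose_quotient_map quotient_map_SO2_orbit by blast
  have "continuous_map (subtopology (top_of_set ?C) ?S) (moduli_topology (a, b) F\<^sub>2 F\<^sub>3) SO2_orbit"
    by (intro continuous_map_from_subtopology quotient_imp_continuous_map quotient_map_SO2_orbit)
  moreover have "?C \<inter> ?S = ?S" by (auto simp: slice_def)
  ultimately have f: "continuous_map (top_of_set ?S) (moduli_topology (a, b) F\<^sub>2 F\<^sub>3) SO2_orbit"
    by (simp add: subtopology_subtopology)
  have "homeomorphic_maps (top_of_set ?S) (moduli_topology (a, b) F\<^sub>2 F\<^sub>3) SO2_orbit g"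
    unfolding homeomorphic_maps_def
    using f g \<nu>_fix SO2_orbit_rotate[OF phase] by (auto simp: g_orbit moduli_def \<nu>_def)
  then show ?thesis by (metis homeomorphic_maps_map)
qed

section \<open>Topological preliminaries\<close>

lemma compact_space_sum_topology:
  assumes "finite I" "\<And>i. i \<in> I \<Longrightarrow> compact_space (X i)"
  shows "compact_space (sum_topology X I)"
proof -
  have "compactin (sum_topology X I) (Pair i ` topspace (X i))" if "i \<in> I" for i
    using assms(2)[OF that] continuous_map_component_injection[OF that]
    by (intro image_compactin) (auto simp: compact_space_def)
  then have "compactin (sum_topology X I) (\<Union>i\<in>I. Pair i ` topspace (X i))"
    using assms(1) by (intro compactin_Union) auto
  moreover have "(\<Union>i\<in>I. Pair i ` topspace (X i)) = topspace (sum_topology X I)" by auto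
  ultimately show ?thesis by (simp add: compact_space_def)
qed

lemma continuous_map_from_sum_topology:
  assumes "\<And>i. i \<in> I \<Longrightarrow> continuous_map (X i) Y (\<lambda>x. f (i, x))"
  shows "continuous_map (sum_topology X I) Y f"
  unfolding continuous_map_def
proof (intro conjI allI impI)
  show "f \<in> topspace (sum_topology X I) \<rightarrow> topspace Y"
    using assms by (auto simp: continuous_map_def Pi_iff)
  fix U assume U: "openin Y U"
  have "openin (X i) {x. (i, x) \<in> {w \<in> topspace (sum_topology X I). f w \<in> U}}" if "i \<in> I" for i
  proof -
    have "{x. (i, x) \<in> {w \<in> topspace (sum_topology X I). f w \<in> U}} = {x \<in> topspace (X i). f (i, x) \<in> U}"
      using that by auto
    then show ?thesis using assms[OF that] U by (simp add: continuous_map_def)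
  qed
  then show "openin (sum_topology X I) {w \<in> topspace (sum_topology X I). f w \<in> U}"
    by (auto simp: openin_sum_topology)
qed

lemma card_connected_components_of_label:
  assumes "\<And>x y. x \<in> topspace X \<Longrightarrow> y \<in> topspace X \<Longrightarrow> connected_component_of X x y \<longleftrightarrow> g x = g y"
  shows "card (connected_components_of X) = card (g ` topspace X)"
proof -
  have "connected_components_of X = (\<lambda>l. {y \<in> topspace X. g y = l}) ` g ` topspace X"
    unfolding connected_components_of_def image_image
  proof (intro image_cong refl set_eqI)
    fix x y assume "x \<in> topspace X"
    then show "y \<in> connected_component_of_set X x \<longleftrightarrow> y \<in> {y \<in> topspace X. g y = g x}"
      using assms[of x y] connected_component_in_topspace[of X x y] by auto
  qed
  moreover have "inj_on (\<lambda>l. {y \<in> topspace X. g y = l}) (g ` topspace X)"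
    by (rule inj_onI) blast
  ultimately show ?thesis by (simp add: card_image)
qed

lemma card_connected_components_of_homeomorphic:
  assumes "homeomorphic_map X Y f"
  shows "card (connected_components_of Y) = card (connected_components_of X)"
proof -
  have "inj_on ((`) f) (connected_components_of X)"
    using connected_components_of_subset
    by (intro inj_on_subset[OF inj_on_image_Pow[OF homeomorphic_imp_injective_map[OF assms]]]) auto
  then show ?thesis
    by (simp add: homeomorphic_map_connected_components_of[OF assms] card_image)
qed

lemma sgn_eq_on_connected:
  fixes h :: "'a::topological_space \<Rightarrow> real"
  assumes "connected T" "continuous_on T h" "\<And>x. x \<in> T \<Longrightarrow> h x \<noteq> 0" "x \<in> T" "y \<in> T"
  shows "sgn (h x) = sgn (h y)"
proof (rule ccontr)
  assume ne: "sgn (h x) \<noteq> sgn (h y)"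
  have "connected (h ` T)" using assms by (intro connected_continuous_image)
  moreover have "h x \<in> h ` T" "h y \<in> h ` T" using assms by auto
  moreover have "h x \<le> 0 \<and> 0 \<le> h y \<or> h y \<le> 0 \<and> 0 \<le> h x"
    using ne by (auto simp: sgn_if split: if_splits)
  ultimately have "0 \<in> h ` T" using connectedD_interval by blast
  then show False using assms(3) by auto
qed

section \<open>The circle described by the first linkage\<close>

locale opening_linkage =
  fixes a b :: real
  assumes a_pos: "a > 0" and b_pos: "b > 0" and a_neq_b: "a \<noteq> b"
begin

text \<open>The endpoint of the first linkage with its elbow at \<open>a\<close> and its angle at \<open>Arg2pi z\<close>. The angle is
  measured clockwise from the edge pointing back to the origin, which accounts for the minus sign and
  the conjugation.\<close>

definition tip :: "complex \<Rightarrow> complex" where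
  "tip z = of_real a - of_real b * cnj z"

text \<open>The triangle inequalities for legs \<open>p\<close> and \<open>q\<close> over every base length between \<open>\<bar>a - b\<bar>\<close> and
  \<open>a + b\<close>, that is, over every distance reached by the first linkage.\<close>

definition spans :: "real \<Rightarrow> real \<Rightarrow> bool" where
  "spans p q \<longleftrightarrow> p > 0 \<and> q > 0 \<and> a + b \<le> p + q \<and> \<bar>p - q\<bar> \<le> \<bar>a - b\<bar>"

text \<open>For \<open>p\<close> and \<open>q\<close> with \<open>spans p q\<close> this says that the triangle over some base \<open>tip z\<close> is degenerate, so
  that the two elbow positions are pinned together there; see \<open>pinned_iff\<close>.\<close>

definition pinned :: "real \<Rightarrow> real \<Rightarrow> bool" where
  "pinned p q \<longleftrightarrow> p + q = a + b \<or> \<bar>p - q\<bar> = \<bar>a - b\<bar>"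

lemma linkage_over_circle:
  assumes "cmod z = 1"
  shows "(0, of_real a, tip z) \<in> free_linkage (a, b)"
  using a_pos b_pos assms by (simp add: free_linkage_def tip_def dist_norm norm_mult)

lemma angle_over_circle:
  assumes "cmod z = 1"
  shows "cis (middle_angle (0, of_real a, tip z)) = z"
proof -
  have "z * cnj z = 1" using assms by (simp add: complex_norm_square[symmetric])
  then have "cnj z = inverse z" by (metis inverse_unique)
  then have "(0 - of_real a) / (tip z - of_real a) = z * of_real (a / b)"
    by (simp add: tip_def divide_inverse mult_ac)
  then have "middle_angle (0, of_real a, tip z) = Arg2pi z"
    using a_pos b_pos Arg2pi_times_of_real2[of "a / b" z] by (simp add: middle_angle_def)
  then show ?thesis using assms complex_norm_eq_1_exp[of z] by (simp add: cis_conv_exp)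
qed

lemma tip_bounds:
  assumes "cmod z = 1"
  shows "\<bar>a - b\<bar> \<le> cmod (tip z)" "cmod (tip z) \<le> a + b"
  using span_bounds[OF linkage_over_circle[OF assms]] by (auto simp: initial_def terminal_def)

lemma tip_extreme_iff:
  assumes "cmod z = 1"
  shows "cmod (tip z) = a + b \<longleftrightarrow> z = -1" "cmod (tip z) = \<bar>a - b\<bar> \<longleftrightarrow> z = 1"
proof -
  let ?u = "(0, of_real a, tip z) :: config"
  note iffs = middle_angle_eq_pi_iff[OF linkage_over_circle[OF assms] a_pos b_pos]
    middle_angle_eq_0_iff[OF linkage_over_circle[OF assms] a_pos b_pos]
  have "middle_angle ?u = 0 \<longleftrightarrow> z = 1"
    using cis_eq_1_iff[OF middle_angle_bounds] angle_over_circle[OF assms] by metis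
  moreover have "middle_angle ?u = pi \<longleftrightarrow> z = -1"
    using cis_eq_minus_1_iff[OF middle_angle_bounds] angle_over_circle[OF assms] by metis
  ultimately show "cmod (tip z) = a + b \<longleftrightarrow> z = -1" "cmod (tip z) = \<bar>a - b\<bar> \<longleftrightarrow> z = 1"
    using iffs by (auto simp: initial_def terminal_def)
qed

lemma tip_nonzero: "cmod z = 1 \<Longrightarrow> tip z \<noteq> 0"
  using tip_bounds(1)[of z] a_neq_b by auto

lemma spans_bounds:
  assumes "spans p q" "cmod z = 1"
  shows "\<bar>p - q\<bar> \<le> cmod (tip z)" "cmod (tip z) \<le> p + q"
  using assms tip_bounds[of z] by (auto simp: spans_def)

text \<open>The base lengths at which a triangle with legs \<open>p\<close> and \<open>q\<close> degenerates bound the range of lengths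
  that it allows. This range contains the range of \<open>cmod (tip z)\<close>, so degeneration can occur only
  where the two ranges share an end.\<close>

lemma altitude_over_circle:
  assumes "spans p q" "cmod z = 1"
  shows "altitude p q (cmod (tip z)) = 0 \<longleftrightarrow>
    z = -1 \<and> p + q = a + b \<or> z = 1 \<and> \<bar>p - q\<bar> = \<bar>a - b\<bar>"
proof -
  have "cmod (tip z) = p + q \<longleftrightarrow> cmod (tip z) = a + b \<and> p + q = a + b"
    using assms tip_bounds[of z] by (auto simp: spans_def)
  moreover have "cmod (tip z) = \<bar>p - q\<bar> \<longleftrightarrow> cmod (tip z) = \<bar>a - b\<bar> \<and> \<bar>p - q\<bar> = \<bar>a - b\<bar>"
    using assms tip_bounds[of z] by (auto simp: spans_def)
  ultimately show ?thesis
    using altitude_eq_0_iff[OF _ spans_bounds[OF assms]] tip_nonzero[OF assms(2)]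
      tip_extreme_iff[OF assms(2)] by auto
qed

lemma elbow_over_circle:
  assumes "spans p q" "cmod z = 1"
  shows "(0, y, tip z) \<in> free_linkage (p, q) \<longleftrightarrow> (\<exists>s\<in>{1, -1}. y = elbow p q s (tip z))"
  using elbow_iff[OF tip_nonzero[OF assms(2)] _ _ spans_bounds[OF assms]] assms(1)
  by (simp add: free_linkage_def spans_def)

lemma continuous_on_tip: "continuous_on S tip"
  unfolding tip_def by (intro continuous_intros)

lemma continuous_on_elbow_tip: "continuous_on (sphere 0 1) (\<lambda>z. elbow p q s (tip z))"
proof -
  have "0 \<notin> tip ` sphere 0 1" using tip_nonzero by (metis image_iff mem_sphere_0)
  then show ?thesis
    using continuous_on_compose[OF continuous_on_tip continuous_on_elbow] by (simp add: o_def)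
qed

lemma pinned_iff:
  assumes "spans p q"
  shows "pinned p q \<longleftrightarrow> (\<exists>z. cmod z = 1 \<and> altitude p q (cmod (tip z)) = 0)"
proof
  assume "pinned p q"
  then show "\<exists>z. cmod z = 1 \<and> altitude p q (cmod (tip z)) = 0"
    using altitude_over_circle[OF assms, of 1] altitude_over_circle[OF assms, of "-1"]
    unfolding pinned_def by (metis norm_minus_cancel norm_one)
qed (use altitude_over_circle[OF assms] in \<open>auto simp: pinned_def\<close>)

lemma card_elbows:
  assumes "spans p q" "cmod z = 1"
  shows "card ((\<lambda>s. elbow p q s (tip z)) ` {1, -1}) =
    (if z = -1 \<and> p + q = a + b \<or> z = 1 \<and> \<bar>p - q\<bar> = \<bar>a - b\<bar> then 1 else 2)"
  using elbow_eq_iff[OF tip_nonzero[OF assms(2)], of p q 1 "-1"] altitude_over_circle[OF assms]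
  by (auto simp: card_insert_if)

end

section \<open>The four sheets\<close>

locale three_linkages = opening_linkage +
  fixes c d e f :: real
  assumes spans_cd: "spans c d" and spans_ef: "spans e f"
begin

abbreviation C :: "config_triple set" where "C \<equiv> config_space (a, b) (c, d) (e, f)"
abbreviation M :: "config_triple set set" where "M \<equiv> moduli (a, b) (c, d) (e, f)"
abbreviation MT :: "config_triple set topology" where
  "MT \<equiv> moduli_topology (a, b) (c, d) (e, f)"
abbreviation S :: "config_triple set" where "S \<equiv> slice (a, b) (c, d) (e, f)"

definition sheet :: "real \<Rightarrow> real \<Rightarrow> complex \<Rightarrow> config_triple" where
  "sheet s r z = ((0, of_real a, tip z), (0, elbow c d s (tip z), tip z),
    (0, elbow e f r (tip z), tip z))"

lemma sheet_in_slice: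
  assumes "cmod z = 1" "s \<in> {1, -1}" "r \<in> {1, -1}"
  shows "sheet s r z \<in> S"
proof -
  have "(0, elbow c d s (tip z), tip z) \<in> free_linkage (c, d)"
    "(0, elbow e f r (tip z), tip z) \<in> free_linkage (e, f)"
    using assms(2,3) elbow_over_circle[OF spans_cd assms(1)] elbow_over_circle[OF spans_ef assms(1)]
    by blast+
  then show ?thesis
    using linkage_over_circle[OF assms(1)]
    by (simp add: slice_def sheet_def config_space_def initial_def terminal_def)
qed

lemma slice_sheetE:
  assumes "u \<in> S"
  obtains s r z where "s \<in> {1, -1}" "r \<in> {1, -1}" "cmod z = 1" "u = sheet s r z"
proof -
  obtain y w t where u: "u = ((0, of_real a, t), (0, y, t), (0, w, t))"
    using assms
    by (auto simp: slice_def config_space_def initial_def terminal_def)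
  define z where "z = cnj ((of_real a - t) / of_real b)"
  have t: "t = tip z" using b_pos by (simp add: tip_def z_def)
  have F: "(0, of_real a, t) \<in> free_linkage (a, b)" "(0, y, t) \<in> free_linkage (c, d)"
    "(0, w, t) \<in> free_linkage (e, f)"
    using assms by (auto simp: u slice_def config_space_def)
  have z: "cmod z = 1"
    using F(1) b_pos by (simp add: free_linkage_def z_def dist_norm norm_divide flip: complex_cnj_divide)
  show thesis
    using F(2,3) elbow_over_circle[OF spans_cd z] elbow_over_circle[OF spans_ef z] that z
    unfolding u t sheet_def by blast
qed

lemma continuous_on_sheet: "continuous_on (sphere 0 1) (sheet s r)"
  unfolding sheet_def
  by (intro continuous_intros continuous_on_elbow_tip continuous_on_tip)

lemma angle_map_sheet:
  assumes "cmod z = 1"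
  shows "angle_map (SO2_orbit (sheet s r z)) = z"
  using angle_over_circle[OF assms]
  by (simp add: angle_map_def theta_SO2_orbit linkage_def sheet_def)

text \<open>The endpoint determines \<open>z\<close>, so two sheets can meet only at equal parameters, and then only where
  the elbow positions in which they differ coincide.\<close>

lemma sheet_eq_iff:
  assumes "cmod z = 1" "cmod z' = 1"
  shows "sheet s r z = sheet s' r' z' \<longleftrightarrow> z = z' \<and>
    (s = s' \<or> altitude c d (cmod (tip z)) = 0) \<and> (r = r' \<or> altitude e f (cmod (tip z)) = 0)"
proof -
  have "tip z = tip z' \<longleftrightarrow> z = z'" using b_pos by (simp add: tip_def)
  then show ?thesis
    using elbow_eq_iff[OF tip_nonzero[OF assms(1)]] by (auto simp: sheet_def)
qed

lemma homeomorphic_map_orbit: "homeomorphic_map (top_of_set S) MT SO2_orbit"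
  using homeomorphic_map_slice[OF a_pos] .

lemma inj_on_orbit: "inj_on SO2_orbit S" and orbit_image: "SO2_orbit ` S = M"
  using homeomorphic_imp_injective_map[OF homeomorphic_map_orbit]
    homeomorphic_imp_surjective_map[OF homeomorphic_map_orbit] by auto

subsection \<open>Gluing four circles\<close>

text \<open>The four sheets map a compact space continuously onto a Hausdorff space, which makes the map a
  quotient map. Identifications require a degenerate triangle and hence occur only over \<open>1\<close>
  and \<open>-1\<close>.\<close>

lemma obtained_from_four_circles: "obtained_from_circles 4 MT"
proof -
  let ?I = "{..<4::nat}" and ?P = "{1, -1} \<times> {1, -1} :: (real \<times> real) set"
  let ?D = "sum_topology (\<lambda>_. top_of_set (sphere (0::complex) 1)) ?I"
  \<comment> \<open>The two binary digits of the index of a circle are the two signs of the sheet.\<close>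
  define \<sigma> where "\<sigma> i = ((if even i then 1 else -1, if i < 2 then 1 else -1) :: real \<times> real)"
    for i :: nat
  have I: "?I = {0, 1, 2, 3}" by auto
  have inj: "inj_on \<sigma> ?I" by (auto simp: I \<sigma>_def inj_on_def)
  have img: "\<sigma> ` ?I = ?P" unfolding I by (auto simp: \<sigma>_def)
  define h where "h = (\<lambda>(i, z). sheet (fst (\<sigma> i)) (snd (\<sigma> i)) z)"
  have \<sigma>: "fst (\<sigma> i) \<in> {1, -1}" "snd (\<sigma> i) \<in> {1, -1}" for i by (auto simp: \<sigma>_def)
  have h_slice: "h (i, z) \<in> S" if "cmod z = 1" for i z
    using sheet_in_slice[OF that \<sigma>] by (simp add: h_def)
  have D: "topspace ?D = ?I \<times> sphere 0 1" by auto
  have "h ` topspace ?D = S"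
  proof (intro equalityI subsetI)
    fix u assume "u \<in> S"
    then obtain s r z where u: "s \<in> {1, -1}" "r \<in> {1, -1}" "cmod z = 1" "u = sheet s r z"
      by (rule slice_sheetE)
    then have "(s, r) \<in> \<sigma> ` ?I" unfolding img by blast
    then obtain i where i: "i \<in> ?I" "\<sigma> i = (s, r)" by (metis imageE)
    have "u = h (i, z)" by (simp add: h_def i(2) u(4))
    then show "u \<in> h ` topspace ?D"
      unfolding D using i(1) u(3) by (intro image_eqI[of _ _ "(i, z)"]) auto
  qed (use h_slice in \<open>auto simp: D\<close>)
  moreover have "continuous_map ?D (top_of_set S) h"
  proof (rule continuous_map_from_sum_topology)
    fix i
    have "continuous_on (sphere 0 1) (\<lambda>z. h (i, z))"
      unfolding h_def prod.case by (rule continuous_on_sheet)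
    then show "continuous_map (top_of_set (sphere 0 1)) (top_of_set S) (\<lambda>z. h (i, z))"
      using h_slice by (auto simp: image_subset_iff)
  qed
  moreover have "compact_space ?D"
    by (intro compact_space_sum_topology) (auto simp: compact_space_subtopology)
  ultimately have "quotient_map ?D (top_of_set S) h"
    by (intro T1_Spaces.continuous_imp_quotient_map) (auto simp: Hausdorff_space_subtopology)
  then have "quotient_map ?D MT (SO2_orbit \<circ> h)"
    using homeomorphic_map_orbit homeomorphic_map_def quotient_map_compose by blast
  moreover have "finite {w \<in> topspace ?D. \<exists>w'\<in>topspace ?D. w' \<noteq> w \<and> (SO2_orbit \<circ> h) w' = (SO2_orbit \<circ> h) w}"
  proof (rule finite_subset)
    show "finite (?I \<times> {1, -1 :: complex})" by auto
    show "{w \<in> topspace ?D. \<exists>w'\<in>topspace ?D. w' \<noteq> w \<and> (SO2_orbit \<circ> h) w' = (SO2_orbit \<circ> h) w}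
        \<subseteq> ?I \<times> {1, -1}"
    proof
      fix w assume "w \<in> {w \<in> topspace ?D. \<exists>w'\<in>topspace ?D. w' \<noteq> w \<and> (SO2_orbit \<circ> h) w' = (SO2_orbit \<circ> h) w}"
      then obtain w' where "w \<in> topspace ?D" "w' \<in> topspace ?D" "w' \<noteq> w"
        "(SO2_orbit \<circ> h) w' = (SO2_orbit \<circ> h) w" by blast
      moreover obtain i z where w: "w = (i, z)" by (rule prod.exhaust)
      moreover obtain j z' where "w' = (j, z')" by (rule prod.exhaust)
      ultimately have "(i, z) \<in> topspace ?D" "(j, z') \<in> topspace ?D"
        and ne: "(j, z') \<noteq> (i, z)" and eq: "(SO2_orbit \<circ> h) (j, z') = (SO2_orbit \<circ> h) (i, z)"
        by simp_all
      then have ij: "i \<in> ?I" "j \<in> ?I" and z: "cmod z = 1" "cmod z' = 1" by (auto simp: D)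
      have "h (j, z') = h (i, z)"
        using eq inj_onD[OF inj_on_orbit _ h_slice[OF z(2)] h_slice[OF z(1)]] by simp
      then have *: "z' = z" "fst (\<sigma> j) = fst (\<sigma> i) \<or> altitude c d (cmod (tip z)) = 0"
          "snd (\<sigma> j) = snd (\<sigma> i) \<or> altitude e f (cmod (tip z)) = 0"
        using sheet_eq_iff[OF z(2,1)] by (auto simp: h_def)
      have "\<sigma> j \<noteq> \<sigma> i" using ne *(1) inj_onD[OF inj _ ij(2,1)] by auto
      then have "altitude c d (cmod (tip z)) = 0 \<or> altitude e f (cmod (tip z)) = 0"
        using * prod_eq_iff by metis
      then have "z \<in> {1, -1}"
        using altitude_over_circle[OF spans_cd z(1)] altitude_over_circle[OF spans_ef z(1)] by auto
      with ij show "w \<in> ?I \<times> {1, -1}" by (simp add: w)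
    qed
  qed
  ultimately show ?thesis unfolding obtained_from_circles_def Let_def by blast
qed

subsection \<open>Fibres of the angle\<close>

text \<open>Over a fixed endpoint the elbows of the second and the third linkage are chosen independently.\<close>

lemma card_angle_fibre:
  assumes "cmod z = 1"
  shows "card {K \<in> M. angle_map K = z} =
    card ((\<lambda>s. elbow c d s (tip z)) ` {1, -1}) * card ((\<lambda>r. elbow e f r (tip z)) ` {1, -1})"
proof -
  let ?A = "(\<lambda>s. elbow c d s (tip z)) ` {1, -1}" and ?B = "(\<lambda>r. elbow e f r (tip z)) ` {1, -1}"
  define h where "h = (\<lambda>(y, w). ((0, of_real a, tip z), (0, y, tip z), (0, w, tip z)) :: config_triple)"
  have sheet_h: "sheet s r z = h (elbow c d s (tip z), elbow e f r (tip z))" for s r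
    by (simp add: sheet_def h_def)
  have h_slice: "h ` (?A \<times> ?B) \<subseteq> S"
    using sheet_in_slice[OF assms] by (auto simp flip: sheet_h)
  have "{K \<in> M. angle_map K = z} = SO2_orbit ` h ` (?A \<times> ?B)"
  proof (intro equalityI subsetI)
    fix K assume K: "K \<in> {K \<in> M. angle_map K = z}"
    then have "K \<in> SO2_orbit ` S" by (simp add: orbit_image)
    then obtain u where u: "u \<in> S" "K = SO2_orbit u" by blast
    obtain s r z' where srz: "s \<in> {1, -1}" "r \<in> {1, -1}" "cmod z' = 1" "u = sheet s r z'"
      using u(1) by (rule slice_sheetE)
    have "z' = z" using K angle_map_sheet[OF srz(3)] by (simp add: u(2) srz(4))
    then have "u \<in> h ` (?A \<times> ?B)" using srz by (auto simp: sheet_h)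
    then show "K \<in> SO2_orbit ` h ` (?A \<times> ?B)" using u(2) by blast
  next
    fix K assume "K \<in> SO2_orbit ` h ` (?A \<times> ?B)"
    then obtain s r where "s \<in> {1, -1}" "r \<in> {1, -1}" "K = SO2_orbit (sheet s r z)"
      unfolding sheet_h by blast
    then show "K \<in> {K \<in> M. angle_map K = z}"
      using angle_map_sheet[OF assms] sheet_in_slice[OF assms] orbit_image by blast
  qed
  moreover have "inj_on SO2_orbit (h ` (?A \<times> ?B))"
    using inj_on_orbit h_slice by (rule inj_on_subset)
  moreover have "inj_on h (?A \<times> ?B)" by (auto simp: inj_on_def h_def)
  ultimately show ?thesis by (simp only: card_image card_cartesian_product)
qed

subsection \<open>Connected components\<close>

text \<open>The sign of this number tells on which side of the line from the origin to the endpoint the elbow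
  lies.\<close>

definition side :: "config \<Rightarrow> real" where
  "side u = Im (fst (snd u) / terminal u)"

text \<open>The sides of the two elbows, except that the side of a pinned linkage is replaced by \<open>0\<close>, because it
  can be changed by moving through a degenerate triangle.\<close>

definition label :: "config_triple \<Rightarrow> real \<times> real" where
  "label u = (if pinned c d then 0 else sgn (side (linkage 2 u)),
              if pinned e f then 0 else sgn (side (linkage 3 u)))"

lemma side_elbow:
  assumes "t \<noteq> 0"
  shows "side (0, elbow p q s t, t) = s * altitude p q (cmod t)"
  using assms by (simp add: side_def elbow_def terminal_def)

lemma altitude_pos:
  assumes "spans p q" "\<not> pinned p q" "cmod z = 1"
  shows "altitude p q (cmod (tip z)) > 0"
proof -
  have "altitude p q (cmod (tip z)) \<noteq> 0" using pinned_iff assms by blast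
  moreover have "altitude p q (cmod (tip z)) \<ge> 0"
    using altitude_nonneg[OF _ spans_bounds[OF assms(1,3)]] tip_nonzero[OF assms(3)] by simp
  ultimately show ?thesis by simp
qed

lemma sgn_side_elbow:
  assumes "spans p q" "\<not> pinned p q" "cmod z = 1" "s \<in> {1, -1}"
  shows "sgn (side (0, elbow p q s (tip z), tip z)) = s"
  using altitude_pos[OF assms(1-3)] assms(4) side_elbow[OF tip_nonzero[OF assms(3)]]
  by (auto simp: sgn_mult)

lemma label_sheet:
  assumes "cmod z = 1" "s \<in> {1, -1}" "r \<in> {1, -1}"
  shows "label (sheet s r z) = (if pinned c d then 0 else s, if pinned e f then 0 else r)"
  using sgn_side_elbow[OF spans_cd _ assms(1,2)] sgn_side_elbow[OF spans_ef _ assms(1,3)]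
  by (simp add: label_def linkage_def sheet_def)

lemma continuous_on_side: "i \<in> {2, 3} \<Longrightarrow> continuous_on S (\<lambda>u. side (linkage i u))"
proof -
  assume i: "i \<in> {2, 3}"
  have nz: "snd (snd (fst (snd u))) \<noteq> 0" "snd (snd (snd (snd u))) \<noteq> 0" if u: "u \<in> S" for u
  proof -
    obtain s r z where "cmod z = 1" "u = sheet s r z" using u by (rule slice_sheetE)
    then show "snd (snd (fst (snd u))) \<noteq> 0" "snd (snd (snd (snd u))) \<noteq> 0"
      using tip_nonzero by (auto simp: sheet_def)
  qed
  show ?thesis
    using i nz unfolding side_def linkage_def terminal_def case_prod_unfold
    by (auto intro!: continuous_intros)
qed

lemma connected_component_sheet:
  assumes "cmod z = 1" "cmod z' = 1" "s \<in> {1, -1}" "r \<in> {1, -1}"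
  shows "connected_component_of (top_of_set S) (sheet s r z) (sheet s r z')"
proof -
  have "connected (sheet s r ` sphere 0 1)"
    by (intro connected_continuous_image continuous_on_sheet connected_sphere) simp
  moreover have "sheet s r ` sphere 0 1 \<subseteq> S" using sheet_in_slice assms by auto
  ultimately show ?thesis
    unfolding connected_component_of_def connectedin_subtopology
    using assms by (intro exI[of _ "sheet s r ` sphere 0 1"]) auto
qed

text \<open>Each linkage is moved along its sheet to a parameter where the two sheets meet and is then continued
  on the other sheet. The two linkages may be pinned at different parameters, so their sides are
  changed one after the other.\<close>

lemma connected_component_switch:
  assumes z: "cmod z = 1" "cmod z' = 1"
    and "s \<in> {1, -1}" "s' \<in> {1, -1}" "r \<in> {1, -1}" "r' \<in> {1, -1}"
    and s: "s = s' \<or> pinned c d" and r: "r = r' \<or> pinned e f"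
  shows "connected_component_of (top_of_set S) (sheet s r z) (sheet s' r' z')"
proof -
  have switch: "connected_component_of (top_of_set S) (sheet s r z) (sheet s' r' z')"
    if "sheet s r w = sheet s' r' w" "cmod w = 1" "cmod z = 1" "cmod z' = 1"
      "s \<in> {1, -1}" "s' \<in> {1, -1}" "r \<in> {1, -1}" "r' \<in> {1, -1}" for s s' r r' w z z'
  proof (rule connected_component_of_trans)
    show "connected_component_of (top_of_set S) (sheet s r z) (sheet s' r' w)"
      using connected_component_sheet[of z w s r] that by simp
    show "connected_component_of (top_of_set S) (sheet s' r' w) (sheet s' r' z')"
      using connected_component_sheet[of w z' s' r'] that by simp
  qed
  \<comment> \<open>If \<open>s = s'\<close>, any parameter serves as the meeting point.\<close>
  obtain w where w: "cmod w = 1" "sheet s r w = sheet s' r w"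
    using s z(1) pinned_iff[OF spans_cd] sheet_eq_iff by metis
  obtain w' where w': "cmod w' = 1" "sheet s' r w' = sheet s' r' w'"
    using r z(1) pinned_iff[OF spans_ef] sheet_eq_iff by metis
  show ?thesis
    using connected_component_of_trans[OF switch[OF w(2,1) z] switch[OF w'(2,1) z(2) z(2)]] assms
    by simp
qed

lemma connected_component_iff_label:
  assumes "u \<in> S" "u' \<in> S"
  shows "connected_component_of (top_of_set S) u u' \<longleftrightarrow> label u = label u'"
proof
  assume "connected_component_of (top_of_set S) u u'"
  then obtain T where T: "connected T" "T \<subseteq> S" "u \<in> T" "u' \<in> T"
    by (auto simp: connected_component_of_def connectedin_subtopology)
  have "side (linkage 2 v) \<noteq> 0" if "v \<in> T" "\<not> pinned c d" for v
  proof -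
    have "v \<in> S" using T that by blast
    then obtain s r z where "s \<in> {1, -1}" "cmod z = 1" "v = sheet s r z" by (rule slice_sheetE)
    then show ?thesis
      using sgn_side_elbow[OF spans_cd that(2), of z s] by (auto simp: linkage_def sheet_def)
  qed
  moreover have "side (linkage 3 v) \<noteq> 0" if "v \<in> T" "\<not> pinned e f" for v
  proof -
    have "v \<in> S" using T that by blast
    then obtain s r z where "r \<in> {1, -1}" "cmod z = 1" "v = sheet s r z" by (rule slice_sheetE)
    then show ?thesis
      using sgn_side_elbow[OF spans_ef that(2), of z r] by (auto simp: linkage_def sheet_def)
  qed
  moreover have "continuous_on T (\<lambda>v. side (linkage 2 v))" "continuous_on T (\<lambda>v. side (linkage 3 v))"
    using continuous_on_side T(2) by (auto intro: continuous_on_subset)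
  ultimately have "pinned c d \<or> sgn (side (linkage 2 u)) = sgn (side (linkage 2 u'))"
    "pinned e f \<or> sgn (side (linkage 3 u)) = sgn (side (linkage 3 u'))"
    using sgn_eq_on_connected[OF T(1) _ _ T(3,4), of "\<lambda>v. side (linkage 2 v)"]
      sgn_eq_on_connected[OF T(1) _ _ T(3,4), of "\<lambda>v. side (linkage 3 v)"] by blast+
  then show "label u = label u'" by (auto simp: label_def)
next
  assume label: "label u = label u'"
  obtain s r z where 1: "s \<in> {1, -1}" "r \<in> {1, -1}" "cmod z = 1" "u = sheet s r z"
    using assms(1) by (rule slice_sheetE)
  obtain s' r' z' where 2: "s' \<in> {1, -1}" "r' \<in> {1, -1}" "cmod z' = 1" "u' = sheet s' r' z'"
    using assms(2) by (rule slice_sheetE)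
  have "s = s' \<or> pinned c d" "r = r' \<or> pinned e f"
    using label label_sheet 1 2 by (auto split: if_splits)
  then show "connected_component_of (top_of_set S) u u'"
    unfolding 1(4) 2(4) using 1 2 by (intro connected_component_switch)
qed

lemma card_components:
  "card (connected_components_of MT) =
    (if pinned c d then 1 else 2) * (if pinned e f then 1 else 2)"
proof -
  define L where "L p q = (if pinned p q then {0} else {1, -1 :: real})" for p q
  have "label ` S = L c d \<times> L e f"
  proof (intro equalityI subsetI)
    fix l assume "l \<in> label ` S"
    then obtain u where u: "u \<in> S" "l = label u" by blast
    obtain s r z where "s \<in> {1, -1}" "r \<in> {1, -1}" "cmod z = 1" "u = sheet s r z"
      using u(1) by (rule slice_sheetE)
    then show "l \<in> L c d \<times> L e f" using label_sheet u(2) by (auto simp: L_def)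
  next
    fix l assume "l \<in> L c d \<times> L e f"
    then obtain s r where "s \<in> {1, -1}" "r \<in> {1, -1}"
      and l: "l = (if pinned c d then 0 else s, if pinned e f then 0 else r)"
      by (cases l) (force simp: L_def split: if_splits)
    then have "l = label (sheet s r 1)" "sheet s r 1 \<in> S"
      using label_sheet[of 1 s r] sheet_in_slice[of 1 s r] by auto
    then show "l \<in> label ` S" by blast
  qed
  moreover have "card (L p q) = (if pinned p q then 1 else 2)" for p q
    by (simp add: L_def)
  moreover have "card (connected_components_of MT) = card (connected_components_of (top_of_set S))"
    using card_connected_components_of_homeomorphic[OF homeomorphic_map_orbit] .
  moreover have "\<dots> = card (label ` S)"
    using card_connected_components_of_label[of "top_of_set S" label] connected_component_iff_label by simp
  ultimately show ?thesis by (simp add: card_cartesian_product)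
qed

subsection \<open>Collapsible and foldable linkages\<close>

text \<open>An angle \<open>\<pi>\<close> at the second linkage means that the endpoint is at distance \<open>c + d\<close>. The first
  linkage reaches at most the distance \<open>a + b \<le> c + d\<close>, so the two must agree, and then the
  configurations over \<open>z = -1\<close> are collapsed. Folding is the same at the other end of the range,
  and the third linkage is treated alike.\<close>

lemma
  assumes "i = 2 \<and> p = c \<and> q = d \<or> i = 3 \<and> p = e \<and> q = f"
  shows collapsible_iff: "collapsible i (a, b) (c, d) (e, f) \<longleftrightarrow> p + q = a + b"
    and foldable_iff: "foldable i (a, b) (c, d) (e, f) \<longleftrightarrow> \<bar>p - q\<bar> = \<bar>a - b\<bar>"
proof -
  have spans: "spans p q" using assms spans_cd spans_ef by auto
  then have pq: "p > 0" "q > 0" by (auto simp: spans_def)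
  let ?dist = "\<lambda>u. dist (initial u) (terminal u)"
  have in_linkage: "linkage i u \<in> free_linkage (p, q)"
    and first: "fst u \<in> free_linkage (a, b)"
    and same: "?dist (fst u) = ?dist (linkage i u)" if "u \<in> C" for u
    using assms that by (auto simp: config_space_def linkage_def)
  have attained: "(\<exists>K\<in>M. (\<forall>u\<in>K. straight (linkage i u)) \<and> theta i K = \<phi>)
      \<longleftrightarrow> (\<exists>u\<in>C. middle_angle (linkage i u) = \<phi>)" if "\<phi> \<in> {0, pi}" for \<phi>
  proof -
    have "straight (linkage i v)"
      if u: "u \<in> C" "middle_angle (linkage i u) = \<phi>" "v \<in> SO2_orbit u" for u v
    proof -
      obtain z where z: "z \<in> SO2" "v = rotate_triple z u" using u(3) by (auto simp: SO2_orbit_def)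
      then have "v \<in> C" using rotate_triple_in_config_space u(1) by blast
      then show ?thesis
        using straight_if_middle_angle[OF in_linkage pq(2)] middle_angle_rotate[OF z(1)] z(2)
          u(2) \<open>\<phi> \<in> {0, pi}\<close> by auto
    qed
    then show ?thesis unfolding moduli_def bex_simps theta_SO2_orbit by blast
  qed
  have base: "sheet 1 1 z \<in> C" "?dist (linkage i (sheet 1 1 z)) = cmod (tip z)"
    if "cmod z = 1" for z
    using sheet_in_slice[OF that, of 1 1] assms
    by (auto simp: slice_def sheet_def linkage_def initial_def terminal_def)
  note bounds = span_bounds[OF first]
  show "collapsible i (a, b) (c, d) (e, f) \<longleftrightarrow> p + q = a + b"
  proof -
    have "collapsible i (a, b) (c, d) (e, f) \<longleftrightarrow> (\<exists>u\<in>C. ?dist (linkage i u) = p + q)"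
      using attained[of pi] middle_angle_eq_pi_iff[OF in_linkage pq] by (auto simp: collapsible_def)
    also have "\<dots> \<longleftrightarrow> p + q = a + b"
      using bounds(2) same spans base[of "-1"] tip_extreme_iff(1)[of "-1"]
      by (fastforce simp: spans_def)
    finally show ?thesis .
  qed
  show "foldable i (a, b) (c, d) (e, f) \<longleftrightarrow> \<bar>p - q\<bar> = \<bar>a - b\<bar>"
  proof -
    have "foldable i (a, b) (c, d) (e, f) \<longleftrightarrow> (\<exists>u\<in>C. ?dist (linkage i u) = \<bar>p - q\<bar>)"
      using attained[of 0] middle_angle_eq_0_iff[OF in_linkage pq] by (auto simp: foldable_def)
    also have "\<dots> \<longleftrightarrow> \<bar>p - q\<bar> = \<bar>a - b\<bar>"
      using bounds(1) same spans base[of 1] tip_extreme_iff(2)[of 1]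
      by (fastforce simp: spans_def)
    finally show ?thesis .
  qed
qed

end

theorem theorem4p2:
  fixes a b c d e f :: real and v\<^sub>1 v\<^sub>2 v\<^sub>3 v\<^sub>4 k :: nat
  assumes "a > 0" "b > 0" "c > 0" "d > 0" "e > 0" "f > 0"
    and "a + b = Min {a + b, c + d, e + f}"
    and "generic (a, b) (c, d) (e, f)"
    and "cis 0 \<in> angle_map ` moduli (a, b) (c, d) (e, f)"
    and "cis pi \<in> angle_map ` moduli (a, b) (c, d) (e, f)"
    and "v\<^sub>1 = of_bool (collapsible 2 (a, b) (c, d) (e, f))"
    and "v\<^sub>2 = of_bool (foldable 2 (a, b) (c, d) (e, f))"
    and "v\<^sub>3 = of_bool (collapsible 3 (a, b) (c, d) (e, f))"
    and "v\<^sub>4 = of_bool (foldable 3 (a, b) (c, d) (e, f))"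
    and "k = count_list [(v\<^sub>1, v\<^sub>2), (v\<^sub>3, v\<^sub>4)] (0, 0)"
  shows "obtained_from_circles 4 (moduli_topology (a, b) (c, d) (e, f)) \<and>
    card (connected_components_of (moduli_topology (a, b) (c, d) (e, f))) = 2 ^ k \<and>
    card {K \<in> moduli (a, b) (c, d) (e, f). angle_map K = cis 0} = 2 ^ (2 - (v\<^sub>2 + v\<^sub>4)) \<and>
    card {K \<in> moduli (a, b) (c, d) (e, f). angle_map K = cis pi} = 2 ^ (2 - (v\<^sub>1 + v\<^sub>3))"
proof -
  obtain u where u: "u \<in> config_space (a, b) (c, d) (e, f)" "cis (middle_angle (fst u)) = 1"
    using assms(9) by (force simp: moduli_def angle_map_def theta_SO2_orbit linkage_def)
  let ?t = "dist (initial (fst u)) (terminal (fst u))"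
  have F: "fst u \<in> free_linkage (a, b)" using u(1) by (auto simp: config_space_def)
  have "?t = \<bar>a - b\<bar>"
    using u(2) cis_eq_1_iff[OF middle_angle_bounds] middle_angle_eq_0_iff[OF F assms(1,2)] by simp
  moreover have "\<bar>c - d\<bar> \<le> ?t"
    using u(1) span_bounds(1)[of "fst (snd u)" c d] by (auto simp: config_space_def)
  moreover have "\<bar>e - f\<bar> \<le> ?t"
    using u(1) span_bounds(1)[of "snd (snd u)" e f] by (auto simp: config_space_def)
  ultimately have near: "\<bar>c - d\<bar> \<le> \<bar>a - b\<bar>" "\<bar>e - f\<bar> \<le> \<bar>a - b\<bar>" by auto
  have far: "a + b \<le> c + d" "a + b \<le> e + f" using assms(7) by auto
  have "a \<noteq> b" using near assms(8) by (auto simp: generic_def)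
  then interpret opening_linkage a b using assms by unfold_locales
  interpret three_linkages a b c d e f
    using near far assms by unfold_locales (auto simp: spans_def)
  have v: "v\<^sub>1 = of_bool (c + d = a + b)" "v\<^sub>2 = of_bool (\<bar>c - d\<bar> = \<bar>a - b\<bar>)"
    "v\<^sub>3 = of_bool (e + f = a + b)" "v\<^sub>4 = of_bool (\<bar>e - f\<bar> = \<bar>a - b\<bar>)"
    using assms(11-14) collapsible_iff foldable_iff by auto
  have "card (connected_components_of MT) = 2 ^ k"
    unfolding card_components assms(15) v pinned_def by auto
  moreover have "card {K \<in> M. angle_map K = cis 0} = 2 ^ (2 - (v\<^sub>2 + v\<^sub>4))"
    using card_angle_fibre[of 1] card_elbows[OF spans_cd, of 1] card_elbows[OF spans_ef, of 1]
    by (auto simp: v)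
  moreover have "card {K \<in> M. angle_map K = cis pi} = 2 ^ (2 - (v\<^sub>1 + v\<^sub>3))"
    using card_angle_fibre[of "-1"] card_elbows[OF spans_cd, of "-1"] card_elbows[OF spans_ef, of "-1"]
    by (auto simp: v)
  ultimately show ?thesis using obtained_from_four_circles by simp
qed

end
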